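(* Let the kernel pair $(M(x),K(x))$ belong to the Luchko set $\mathcal{L}_1(\mathbb{R}_+)$ and let $-\infty<a<b<+\infty$. Then the parametric general fractional integral and the parametric general fractional derivative of Riemann-Liouville type satisfy the equalities $$(I^{(M)}_{a+,g}\,D^{(K)}_{a+,g}f)(x)=f(x),$$ if $f\in C^1_{-1,g}(a,b]$ and $g\in\mathcal{G}(a,b]$, and $$(I^{(M)}_{b-,g}\,D^{(K)}_{b-,g}f)(x)=f(x),$$ if $f\in C^1_{-1,g}[a,b)$ and $g\in\mathcal{G}[a,b)$.
   Context: Function classes. $\mathcal{G}(a,b]$ (resp. $\mathcal{G}[a,b)$) is the set of increasing and positive monotone functions $g$ on $(a,b)$ having a continuous first-order derivative $g^{(1)}$ on $(a,b]$ (resp. on $[a,b)$) such that $g^{(1)}(x)\ne0$ for all $x\in[a,b]$. $f\in C^1_{-1,g}(a,b]$ means that the first-order derivative of $f$ can be represented as $f^{(1)}(x)=(g(x)-g(a))^p\,v_p(x)$ with $v_p\in C[a,b]$ and $p>-1$. $f\in C^1_{-1,g}[a,b)$ means that $f^{(1)}(x)=(g(b)-g(x))^q\,v_q(x)$ with $v_q\in C[a,b]$ and $q>-1$. Kernels. The Luchko set $\mathcal{L}_1(\mathbb{R}_+)$ consists of the pairs $(M(x),K(x))$, $x\in\mathbb{R}_+=(0,\infty)$, such that $M,K\in C_{-1}(0,b-a]$ and the Sonin condition holds: $$\int_0^x M(x-z)K(z)\,dz=\begin{cases}1,& x\in(0,b-a],\\ 0,& x\notin(0,b-a].\end{cases}$$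 Here $F\in C_{-1}(0,b-a]$ means $F(x)=x^pG(x)$ for some $G\in C[0,b-a]$ and $p>-1$. Operators. For $a<x\le b$ (left-sided) and $a\le x<b$ (right-sided): $$(I^{(M)}_{a+,g}f)(x)=\int_a^x M(g(x)-g(u))f(u)g^{(1)}(u)\,du,\qquad (I^{(M)}_{b-,g}f)(x)=\int_x^b M(g(u)-g(x))f(u)g^{(1)}(u)\,du,$$ $$(D^{(K)}_{a+,g}f)(x)=\frac{1}{g^{(1)}(x)}\frac{d}{dx}\int_a^x K(g(x)-g(u))f(u)g^{(1)}(u)\,du,$$ $$(D^{(K)}_{b-,g}f)(x)=-\frac{1}{g^{(1)}(x)}\frac{d}{dx}\int_x^b K(g(u)-g(x))f(u)g^{(1)}(u)\,du.$$
   Formalization: The kernel conditions (M, K in C_{-1} and the Sonin condition equal to 1) are required on (0, g(b)-g(a)] instead of (0, b-a]; with (0, b-a] the equalities fail when g(b)-g(a) > b-a, e.g. for f=1. The value 0 of the Sonin integral outside the interval is not required. *)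

theory Defs
  imports "HOL-Analysis.Analysis"
begin

(* Derivative of a function living on [a,b]; it is one-sided at a and at b. *)
definition deriv_on :: "real \<Rightarrow> real \<Rightarrow> (real \<Rightarrow> real) \<Rightarrow> real \<Rightarrow> real" where
  "deriv_on a b F x = vector_derivative F (at x within {a..b})"

(* The classes G(a,b] and G[a,b). Requiring g'(x) to be nonzero on all of [a,b] presupposes
   that g' exists at both end points, whereas continuity of g' is only required on the
   half-open interval. Monotonicity is not stated in its strict form: strictness follows
   from the derivative being nonzero. *)
definition G_left :: "real \<Rightarrow> real \<Rightarrow> (real \<Rightarrow> real) set" where
  "G_left a b = {g. mono_on {a<..<b} g \<and> (\<forall>x\<in>{a<..<b}. 0 < g x) \<and>
     g differentiable_on {a..b} \<and> continuous_on {a<..b} (deriv_on a b g) \<and>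
     (\<forall>x\<in>{a..b}. deriv_on a b g x \<noteq> 0)}"

definition G_right :: "real \<Rightarrow> real \<Rightarrow> (real \<Rightarrow> real) set" where
  "G_right a b = {g. mono_on {a<..<b} g \<and> (\<forall>x\<in>{a<..<b}. 0 < g x) \<and>
     g differentiable_on {a..b} \<and> continuous_on {a..<b} (deriv_on a b g) \<and>
     (\<forall>x\<in>{a..b}. deriv_on a b g x \<noteq> 0)}"

(* C^1_{-1,g}(a,b] and C^1_{-1,g}[a,b); nothing is required of f at the excluded end point. *)
definition C1_left :: "(real \<Rightarrow> real) \<Rightarrow> real \<Rightarrow> real \<Rightarrow> (real \<Rightarrow> real) set" where
  "C1_left g a b = {f. \<exists>p v. p > -1 \<and> continuous_on {a..b} v \<and>
     (\<forall>x\<in>{a<..b}. (f has_real_derivative (g x - g a) powr p * v x) (at x within {a..b}))}"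

definition C1_right :: "(real \<Rightarrow> real) \<Rightarrow> real \<Rightarrow> real \<Rightarrow> (real \<Rightarrow> real) set" where
  "C1_right g a b = {f. \<exists>q v. q > -1 \<and> continuous_on {a..b} v \<and>
     (\<forall>x\<in>{a..<b}. (f has_real_derivative (g b - g x) powr q * v x) (at x within {a..b}))}"

(* C_{-1}(0,T] *)
definition C_minus1 :: "real \<Rightarrow> (real \<Rightarrow> real) set" where
  "C_minus1 T = {F. \<exists>p G. p > -1 \<and> continuous_on {0..T} G \<and>
     (\<forall>x\<in>{0<..T}. F x = x powr p * G x)}"

(* Luchko pairs on (0,T]. Kernels are total functions here, but only their values on (0,T]
   are constrained: the value 0 of the Sonin convolution outside (0,T] is the convention for
   extending a function on (0,T], and is not imposed as a condition on M and K beyond T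
   (that would exclude the power kernels). The operators below evaluate the kernels at
   g x - g u, so the relevant length is T = g b - g a, which is b - a when g is the identity. *)
definition luchko_set :: "real \<Rightarrow> ((real \<Rightarrow> real) \<times> (real \<Rightarrow> real)) set" where
  "luchko_set T = {(M, K). M \<in> C_minus1 T \<and> K \<in> C_minus1 T \<and>
     (\<forall>x\<in>{0<..T}. integral {0..x} (\<lambda>z. M (x - z) * K z) = 1)}"

(* In the operators below, a and b delimit the interval on which g' and d/dx are taken. *)
definition I_left :: "(real \<Rightarrow> real) \<Rightarrow> (real \<Rightarrow> real) \<Rightarrow> real \<Rightarrow> real \<Rightarrow> (real \<Rightarrow> real) \<Rightarrow> real \<Rightarrow> real" where
  "I_left M g a b f x = integral {a..x} (\<lambda>u. M (g x - g u) * f u * deriv_on a b g u)"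

definition I_right :: "(real \<Rightarrow> real) \<Rightarrow> (real \<Rightarrow> real) \<Rightarrow> real \<Rightarrow> real \<Rightarrow> (real \<Rightarrow> real) \<Rightarrow> real \<Rightarrow> real" where
  "I_right M g a b f x = integral {x..b} (\<lambda>u. M (g u - g x) * f u * deriv_on a b g u)"

definition D_left :: "(real \<Rightarrow> real) \<Rightarrow> (real \<Rightarrow> real) \<Rightarrow> real \<Rightarrow> real \<Rightarrow> (real \<Rightarrow> real) \<Rightarrow> real \<Rightarrow> real" where
  "D_left K g a b f x = 1 / deriv_on a b g x *
     deriv_on a b (\<lambda>y. integral {a..y} (\<lambda>u. K (g y - g u) * f u * deriv_on a b g u)) x"

definition D_right :: "(real \<Rightarrow> real) \<Rightarrow> (real \<Rightarrow> real) \<Rightarrow> real \<Rightarrow> real \<Rightarrow> (real \<Rightarrow> real) \<Rightarrow> real \<Rightarrow> real" where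
  "D_right K g a b f x = - (1 / deriv_on a b g x) *
     deriv_on a b (\<lambda>y. integral {y..b} (\<lambda>u. K (g u - g y) * f u * deriv_on a b g u)) x"

end

theory Submission
  imports Defs
begin

text \<open>Substituting \<open>t = g x - g a\<close> turns the left-sided operators into convolutions \<open>*\<close> on \<open>(0, T]\<close>
  with \<open>T = g b - g a\<close>, and \<open>f\<close> into \<open>H = c + 1 * h\<close>, where \<open>h\<close> is its derivative in \<open>t\<close>. The
  functions that are continuous on \<open>(0, T]\<close> and integrable are closed under \<open>*\<close>, which is
  commutative and associative at every point. Hence \<open>K * H = 1 * (c K + K * h)\<close> has the derivative
  \<open>c K + K * h\<close>, and \<open>M * (c K + K * h) = c (M * K) + (M * K) * h = c + 1 * h = H\<close> by the Sonin
  condition \<open>M * K = 1\<close>. The right-sided case follows by the reflection \<open>x \<mapsto> -x\<close>, with \<open>g\<close>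
  replaced by \<open>-g(-x)\<close>.\<close>

subsection \<open>Convolution of integrable functions continuous on a half-open interval\<close>

text \<open>Nothing but integrability is required beyond \<open>T\<close>, so that the convolution, whose support is
  twice as long, stays in the space; identities between convolutions are only claimed up to \<open>T\<close>.\<close>

definition conv_space :: "real \<Rightarrow> (real \<Rightarrow> real) set" where
  "conv_space T = {F. integrable lborel F \<and> continuous_on {0<..T} F \<and> (\<forall>x\<le>0. F x = 0)}"

text \<open>The integral runs over the whole line. For factors that vanish at nonpositive arguments
  the integrand lives on (0, t), so this is the one-sided convolution, but substitutions require no
  care with limits.\<close>

definition conv :: "(real \<Rightarrow> real) \<Rightarrow> (real \<Rightarrow> real) \<Rightarrow> real \<Rightarrow> real" where
  "conv F G t = (\<integral>z. F (t - z) * G z \<partial>lborel)"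

lemma conv_spaceI:
  "integrable lborel F \<Longrightarrow> continuous_on {0<..T} F \<Longrightarrow> (\<And>x. x \<le> 0 \<Longrightarrow> F x = 0) \<Longrightarrow> F \<in> conv_space T"
  by (simp add: conv_space_def)

lemma conv_spaceD:
  assumes "F \<in> conv_space T"
  shows "integrable lborel F" "continuous_on {0<..T} F" "x \<le> 0 \<Longrightarrow> F x = 0"
  using assms by (simp_all add: conv_space_def)

lemma conv_space_add: "F \<in> conv_space T \<Longrightarrow> G \<in> conv_space T \<Longrightarrow> (\<lambda>x. F x + G x) \<in> conv_space T"
  by (auto simp: conv_space_def intro!: continuous_intros)

lemma conv_space_cmult: "F \<in> conv_space T \<Longrightarrow> (\<lambda>x. c * F x) \<in> conv_space T"
  by (auto simp: conv_space_def intro!: continuous_intros)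

lemma conv_space_abs: "F \<in> conv_space T \<Longrightarrow> (\<lambda>x. \<bar>F x\<bar>) \<in> conv_space T"
  by (auto simp: conv_space_def intro!: continuous_intros)

lemma conv_commute: "conv F G t = conv G F t"
  unfolding conv_def
  using lborel_integral_real_affine[of "-1" "\<lambda>z. F (t - z) * G z" t] by (simp add: mult.commute)

lemma conv_integrable_commute:
  "integrable lborel (\<lambda>z. F (t - z) * G z) \<longleftrightarrow> integrable lborel (\<lambda>z. G (t - z) * F z)"
  for F G :: "real \<Rightarrow> real"
  using lborel_integrable_real_affine_iff[of "-1" "\<lambda>z. F (t - z) * G z" t] by (simp add: mult.commute)

text \<open>Where \<open>G\<close> does not vanish, the argument t - z stays below \<open>T\<close>,
  so the bound on \<open>F\<close> applies and \<open>B * \<bar>G z\<bar>\<close> is an integrable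
  majorant.\<close>

lemma conv_bounded_integrable:
  fixes F G :: "real \<Rightarrow> real"
  assumes "F \<in> borel_measurable borel" "\<And>x. x \<le> T \<Longrightarrow> \<bar>F x\<bar> \<le> B"
    and "integrable lborel G" "\<And>x. x \<le> 0 \<Longrightarrow> G x = 0" "t \<le> T"
  shows "integrable lborel (\<lambda>z. F (t - z) * G z)"
proof (rule Bochner_Integration.integrable_bound)
  show "integrable lborel (\<lambda>z. B * \<bar>G z\<bar>)"
    using assms by auto
  have [measurable]: "F \<in> borel_measurable borel" "G \<in> borel_measurable borel"
    using assms by auto
  show "(\<lambda>z. F (t - z) * G z) \<in> borel_measurable lborel"
    by measurable
  show "AE z in lborel. norm (F (t - z) * G z) \<le> norm (B * \<bar>G z\<bar>)"
  proof (rule AE_I2)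
    fix z
    show "norm (F (t - z) * G z) \<le> norm (B * \<bar>G z\<bar>)"
    proof (cases "z \<le> 0")
      case False
      then have "\<bar>F (t - z)\<bar> \<le> \<bar>B\<bar>" using assms(2)[of "t - z"] assms(5) by linarith
      then show ?thesis by (simp add: abs_mult mult_right_mono)
    qed (use assms in auto)
  qed
qed

text \<open>Dominated convergence with majorant \<open>B * \<bar>G z\<bar>\<close>. A jump of
  \<open>F\<close> at \<open>c\<close> is harmless because it affects only z = t - c, a null set;
  cut-off functions may have such a jump.\<close>

lemma conv_bounded_continuous:
  fixes F G :: "real \<Rightarrow> real"
  assumes F: "F \<in> borel_measurable borel" "\<And>x. x \<le> T \<Longrightarrow> \<bar>F x\<bar> \<le> B"
      "continuous_on ({..T} - {c}) F"
    and G: "integrable lborel G" "\<And>x. x \<le> 0 \<Longrightarrow> G x = 0"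
  shows "continuous_on {..T} (conv F G)"
  unfolding continuous_on_sequentially
proof (intro allI ballI impI, elim conjE)
  fix s t assume s: "\<forall>n. s n \<in> {..T}" and t: "t \<in> {..T}" and lim: "s \<longlonglongrightarrow> t"
  have [measurable]: "F \<in> borel_measurable borel" "G \<in> borel_measurable borel"
    using F G by auto
  have "(\<lambda>n. \<integral>z. F (s n - z) * G z \<partial>lborel) \<longlonglongrightarrow> (\<integral>z. F (t - z) * G z \<partial>lborel)"
  proof (rule integral_dominated_convergence)
    show "integrable lborel (\<lambda>z. B * \<bar>G z\<bar>)"
      using G by auto
    show "AE z in lborel. norm (F (s n - z) * G z) \<le> B * \<bar>G z\<bar>" for n
    proof (rule AE_I2)
      fix z
      show "norm (F (s n - z) * G z) \<le> B * \<bar>G z\<bar>"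
      proof (cases "z \<le> 0")
        case False
        then have "\<bar>F (s n - z)\<bar> \<le> B" using F(2)[of "s n - z"] s[rule_format, of n] by simp
        then show ?thesis by (simp add: abs_mult mult_right_mono)
      qed (use G in auto)
    qed
    show "AE z in lborel. (\<lambda>n. F (s n - z) * G z) \<longlonglongrightarrow> F (t - z) * G z"
      using AE_lborel_singleton[of "t - c"]
    proof eventually_elim
      case (elim z)
      show ?case
      proof (cases "z \<le> 0")
        case False
        have l: "(\<lambda>n. s n - z) \<longlonglongrightarrow> t - z"
          by (intro tendsto_intros lim)
        have "(\<lambda>n. F (s n - z)) \<longlonglongrightarrow> F (t - z)"
        proof (rule continuous_on_tendsto_compose[OF F(3) l])
          show "t - z \<in> {..T} - {c}" using False t elim by auto
          have "\<forall>\<^sub>F n in sequentially. s n - z \<noteq> c"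
            using tendsto_imp_eventually_ne[OF l, of c] elim by force
          then show "\<forall>\<^sub>F n in sequentially. s n - z \<in> {..T} - {c}"
          proof eventually_elim
            case (elim n)
            then show ?case using s[rule_format, of n] False by simp
          qed
        qed
        then show ?thesis by (intro tendsto_intros)
      qed (use G in auto)
    qed
  qed auto
  then show "(conv F G \<circ> s) \<longlonglongrightarrow> conv F G t"
    by (simp add: conv_def o_def)
qed

section \<open>Cut-off functions and continuity of the convolution\<close>

lemma cutoff_bounded:
  fixes F :: "real \<Rightarrow> real"
  assumes "continuous_on {0<..T} F" "0 < c"
  obtains B where "\<And>x. x \<le> T \<Longrightarrow> \<bar>if c < x then F x else 0\<bar> \<le> B"
proof -
  have "compact (F ` {c..T})"
    by (intro compact_continuous_image continuous_on_subset[OF assms(1)]) (use assms in auto)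
  then obtain B where "\<forall>x\<in>F ` {c..T}. norm x \<le> B"
    using compact_imp_bounded bounded_iff by metis
  \<comment> \<open>The maximum with 0 covers the arguments up to \<open>c\<close>, where the
    cut-off function is 0; \<open>B\<close> may be negative if \<open>{c..T}\<close> is
    empty.\<close>
  then have "\<bar>if c < x then F x else 0\<bar> \<le> max B 0" if "x \<le> T" for x
    using that by (auto simp: le_max_iff_disj)
  then show ?thesis using that by blast
qed

text \<open>Without \<open>c\<close> the domain falls into two relatively open pieces; the function
  is 0 on the left one and equals \<open>F\<close> on the right one.\<close>

lemma cutoff_continuous:
  fixes F :: "real \<Rightarrow> real"
  assumes "continuous_on {0<..T} F" "0 < c"
  shows "continuous_on ({..T} - {c}) (\<lambda>x. if c < x then F x else 0)"
proof -
  have *: "{..T} - {c} = ({..T} - {c}) \<inter> {..<c} \<union> ({..T} - {c}) \<inter> {c<..}" by auto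
  show ?thesis
  proof (subst *, rule continuous_on_Un_local_open)
    show "openin (top_of_set (({..T} - {c}) \<inter> {..<c} \<union> ({..T} - {c}) \<inter> {c<..})) (({..T} - {c}) \<inter> {..<c})"
      by (subst *[symmetric]) (intro openin_open_Int open_lessThan)
    show "openin (top_of_set (({..T} - {c}) \<inter> {..<c} \<union> ({..T} - {c}) \<inter> {c<..})) (({..T} - {c}) \<inter> {c<..})"
      by (subst *[symmetric]) (intro openin_open_Int open_greaterThan)
    show "continuous_on (({..T} - {c}) \<inter> {..<c}) (\<lambda>x. if c < x then F x else 0)"
      by (rule continuous_on_eq[of _ "\<lambda>_. 0"]) auto
    show "continuous_on (({..T} - {c}) \<inter> {c<..}) (\<lambda>x. if c < x then F x else 0)"
      by (rule continuous_on_eq[OF continuous_on_subset[OF assms(1)]]) (use assms in auto)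
  qed
qed

lemma cutoff_integrable:
  fixes F :: "real \<Rightarrow> real"
  assumes "integrable lborel F"
  shows "integrable lborel (\<lambda>x. if c < x then F x else 0)"
proof -
  have [measurable]: "F \<in> borel_measurable borel" using assms by auto
  show ?thesis
    by (rule Bochner_Integration.integrable_bound[OF assms]) auto
qed

text \<open>The two factors are singular at opposite ends of the range of integration. Cutting each
  off near its own singularity leaves a product that vanishes identically, so one factor of every
  remaining summand is bounded.\<close>

lemma conv_split:
  fixes F G :: "real \<Rightarrow> real"
  assumes F: "F \<in> conv_space T" and G: "G \<in> conv_space T" and c: "0 < c" "2 * c < t" "t \<le> T"
  defines "F1 \<equiv> \<lambda>x. if c < x then F x else 0" and "G1 \<equiv> \<lambda>x. if c < x then G x else 0"
  shows "integrable lborel (\<lambda>z. F (t - z) * G z)"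
    and "conv F G t = conv F1 G t + conv G1 (\<lambda>x. F x - F1 x) t"
proof -
  note FD = conv_spaceD[OF F] and GD = conv_spaceD[OF G]
  have iF: "integrable lborel F1" and iG: "integrable lborel G1"
    unfolding F1_def G1_def by (intro cutoff_integrable FD GD)+
  obtain B where B: "\<And>x. x \<le> T \<Longrightarrow> \<bar>F1 x\<bar> \<le> B"
    unfolding F1_def using cutoff_bounded[OF FD(2) c(1)] by metis
  obtain B' where B': "\<And>x. x \<le> T \<Longrightarrow> \<bar>G1 x\<bar> \<le> B'"
    unfolding G1_def using cutoff_bounded[OF GD(2) c(1)] by metis
  have 1: "integrable lborel (\<lambda>z. F1 (t - z) * G z)"
    by (rule conv_bounded_integrable[OF _ B]) (use iF GD c in auto)
  have 2: "integrable lborel (\<lambda>z. G1 (t - z) * (F z - F1 z))"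
    by (rule conv_bounded_integrable[OF _ B']) (use iF iG FD c in \<open>auto simp: F1_def\<close>)
  then have 3: "integrable lborel (\<lambda>z. (F (t - z) - F1 (t - z)) * G1 z)"
    using conv_integrable_commute by fastforce
  \<comment> \<open>The omitted product of the two removed parts would need t - z \<le> c and z
    \<le> c, which \<open>2 * c < t\<close> excludes.\<close>
  have eq: "F (t - z) * G z = F1 (t - z) * G z + (F (t - z) - F1 (t - z)) * G1 z" for z
    using c by (auto simp: F1_def G1_def algebra_simps)
  show "integrable lborel (\<lambda>z. F (t - z) * G z)"
    unfolding eq using 1 3 by (rule Bochner_Integration.integrable_add)
  have "conv F G t = conv F1 G t + conv (\<lambda>x. F x - F1 x) G1 t"
    unfolding conv_def eq using 1 3 by (rule Bochner_Integration.integral_add)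
  then show "conv F G t = conv F1 G t + conv G1 (\<lambda>x. F x - F1 x) t"
    by (simp add: conv_commute[of _ G1])
qed

lemma conv_eq_0:
  assumes "F \<in> conv_space T" "G \<in> conv_space T" "t \<le> 0"
  shows "F (t - z) * G z = 0" "conv F G t = 0"
proof -
  show *: "F (t - z) * G z = 0" for z
    using assms conv_spaceD(3)[OF assms(1), of "t - z"] conv_spaceD(3)[OF assms(2), of z]
    by (cases "z \<le> 0") auto
  show "conv F G t = 0" unfolding conv_def * by simp
qed

lemma conv_integrable:
  assumes "F \<in> conv_space T" "G \<in> conv_space T" "t \<le> T"
  shows "integrable lborel (\<lambda>z. F (t - z) * G z)"
proof (cases "t \<le> 0")
  case True
  show ?thesis unfolding conv_eq_0(1)[OF assms(1,2) True] by simp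
qed (use conv_split(1)[OF assms(1,2), of "t / 3" t] assms in auto)

text \<open>Continuity is local: a fixed cut-off \<open>c\<close> below t / 2 makes the
  decomposition of \<open>conv_split\<close> valid at all times in (2 * c, T], a relative
  neighbourhood of t, and each of its summands has a bounded factor.\<close>

lemma conv_continuous:
  assumes F: "F \<in> conv_space T" and G: "G \<in> conv_space T"
  shows "continuous_on {0<..T} (conv F G)"
  unfolding continuous_on_eq_continuous_within
proof
  fix t assume t: "t \<in> {0<..T}"
  note FD = conv_spaceD[OF F] and GD = conv_spaceD[OF G]
  define c where "c = t / 3"
  have c: "0 < c" "2 * c < t" using t by (auto simp: c_def)
  define F1 G1 where "F1 = (\<lambda>x. if c < x then F x else 0)" and "G1 = (\<lambda>x. if c < x then G x else 0)"
  have iF: "integrable lborel F1" and iG: "integrable lborel G1"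
    unfolding F1_def G1_def by (intro cutoff_integrable FD GD)+
  obtain B where B: "\<And>x. x \<le> T \<Longrightarrow> \<bar>F1 x\<bar> \<le> B"
    unfolding F1_def using cutoff_bounded[OF FD(2) c(1)] by metis
  obtain B' where B': "\<And>x. x \<le> T \<Longrightarrow> \<bar>G1 x\<bar> \<le> B'"
    unfolding G1_def using cutoff_bounded[OF GD(2) c(1)] by metis
  have 1: "continuous_on {..T} (conv F1 G)"
    by (rule conv_bounded_continuous[OF _ B])
      (use iF GD c cutoff_continuous[OF FD(2) c(1)] in \<open>auto simp: F1_def\<close>)
  have 2: "continuous_on {..T} (conv G1 (\<lambda>x. F x - F1 x))"
    by (rule conv_bounded_continuous[OF _ B'])
      (use iF iG FD c cutoff_continuous[OF GD(2) c(1)] in \<open>auto simp: F1_def G1_def\<close>)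
  have "continuous_on {2*c<..T} (conv F G)"
  proof (rule continuous_on_eq)
    show "continuous_on {2*c<..T} (\<lambda>t. conv F1 G t + conv G1 (\<lambda>x. F x - F1 x) t)"
      by (intro continuous_intros continuous_on_subset[OF 1] continuous_on_subset[OF 2]) auto
  qed (use conv_split(2)[OF F G c(1)] in \<open>auto simp: F1_def G1_def\<close>)
  then have "continuous (at t within {2*c<..T}) (conv F G)"
    using t c by (auto simp: continuous_on_eq_continuous_within)
  moreover have "at t within {2*c<..T} = at t within {0<..T}"
    by (rule at_within_nhd[of _ "{2*c<..}"]) (use c in auto)
  ultimately show "continuous (at t within {0<..T}) (conv F G)" by simp
qed

section \<open>Closure and associativity of the convolution\<close>

text \<open>Fubini on the product: integrating absolute values over t first, translation invariance
  gives the norm of \<open>F\<close> times \<open>\<bar>G z\<bar>\<close>, which is integrable in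
  z.\<close>

lemma conv_lborel_integrable:
  assumes "integrable lborel F" "integrable lborel G"
  shows "integrable lborel (conv F G)"
proof -
  have [measurable]: "F \<in> borel_measurable borel" "G \<in> borel_measurable borel" using assms by auto
  have sh: "integrable lborel (\<lambda>t. H (t - z))" "(\<integral>t. H (t - z) \<partial>lborel) = integral\<^sup>L lborel H"
    if "integrable lborel H" for H :: "real \<Rightarrow> real" and z
    using lborel_integrable_real_affine[OF that, of 1 "-z"] lborel_integral_real_affine[of 1 H "-z"]
    by auto
  have "integrable (lborel \<Otimes>\<^sub>M lborel) (\<lambda>(z, t). F (t - z) * G z)"
  proof (rule lborel_pair.Fubini_integrable)
    show "(\<lambda>(z, t). F (t - z) * G z) \<in> borel_measurable (lborel \<Otimes>\<^sub>M lborel)"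
      by measurable
    show "integrable lborel (\<lambda>z. \<integral>t. norm (case (z, t) of (z, t) \<Rightarrow> F (t - z) * G z) \<partial>lborel)"
      using sh(2)[of "\<lambda>x. \<bar>F x\<bar>"] assms by (simp add: abs_mult)
    show "AE z in lborel. integrable lborel (\<lambda>t. case (z, t) of (z, t) \<Rightarrow> F (t - z) * G z)"
      using sh(1)[of F] assms by auto
  qed
  from lborel_pair.integrable_product_swap[OF this]
  have "integrable (lborel \<Otimes>\<^sub>M lborel) (\<lambda>(t, z). F (t - z) * G z)"
    by (simp add: case_prod_unfold)
  from lborel_pair.integrable_fst'[OF this] show ?thesis
    by (simp add: conv_def[abs_def])
qed

lemma conv_in_conv_space:
  assumes "F \<in> conv_space T" "G \<in> conv_space T"
  shows "conv F G \<in> conv_space T"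
  using conv_lborel_integrable[OF conv_spaceD(1)[OF assms(1)] conv_spaceD(1)[OF assms(2)]]
    conv_continuous[OF assms] conv_eq_0(2)[OF assms] by (rule conv_spaceI)

text \<open>Fubini for the function \<open>\<Phi>\<close>. Equality holds at every t up to
  \<open>T\<close>, not just almost everywhere, because \<open>conv_integrable\<close>, applied to
  the absolute values of the three functions, gives integrability of \<open>\<Phi>\<close> for each
  such t.\<close>

lemma conv_assoc:
  assumes F: "F \<in> conv_space T" and G: "G \<in> conv_space T" and H: "H \<in> conv_space T" and t: "t \<le> T"
  shows "conv F (conv G H) t = conv (conv F G) H t"
proof -
  have [measurable]: "F \<in> borel_measurable borel" "G \<in> borel_measurable borel" "H \<in> borel_measurable borel"
    using conv_spaceD(1)[OF F] conv_spaceD(1)[OF G] conv_spaceD(1)[OF H] by auto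
  define \<Phi> where "\<Phi> = (\<lambda>(z, w). F (t - z) * (G (z - w) * H w))"
  have int: "integrable (lborel \<Otimes>\<^sub>M lborel) \<Phi>"
  proof (rule lborel_pair.Fubini_integrable)
    show "\<Phi> \<in> borel_measurable (lborel \<Otimes>\<^sub>M lborel)"
      unfolding \<Phi>_def by measurable
    have "(\<integral>w. norm (\<Phi> (z, w)) \<partial>lborel) = \<bar>F (t - z)\<bar> * conv (\<lambda>x. \<bar>G x\<bar>) (\<lambda>x. \<bar>H x\<bar>) z" for z
      by (simp add: \<Phi>_def conv_def abs_mult)
    then show "integrable lborel (\<lambda>z. \<integral>w. norm (\<Phi> (z, w)) \<partial>lborel)"
      using conv_integrable[OF conv_space_abs[OF F]
          conv_in_conv_space[OF conv_space_abs[OF G] conv_space_abs[OF H]] t] by simp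
    \<comment> \<open>For z beyond \<open>T\<close> nothing is known about w \<mapsto> G (z - w) * H
      w, but then t - z < 0 and the factor \<open>F (t - z)\<close> is 0.\<close>
    have "integrable lborel (\<lambda>w. \<Phi> (z, w))" for z
    proof (cases "z \<le> T")
      case True
      then show ?thesis using conv_integrable[OF G H, of z] by (simp add: \<Phi>_def)
    next
      case False
      then show ?thesis using conv_spaceD(3)[OF F, of "t - z"] t by (simp add: \<Phi>_def)
    qed
    then show "AE z in lborel. integrable lborel (\<lambda>w. \<Phi> (z, w))" by simp
  qed
  have "conv F (conv G H) t = (\<integral>z. (\<integral>w. \<Phi> (z, w) \<partial>lborel) \<partial>lborel)"
    by (simp add: conv_def \<Phi>_def)
  also have "\<dots> = (\<integral>w. (\<integral>z. \<Phi> (z, w) \<partial>lborel) \<partial>lborel)"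
    using lborel_pair.Fubini_integral[of "\<lambda>z w. \<Phi> (z, w)"] int by simp
  also have "\<dots> = (\<integral>w. conv F G (t - w) * H w \<partial>lborel)"
  proof (rule Bochner_Integration.integral_cong)
    fix w
    have "(\<integral>z. \<Phi> (z, w) \<partial>lborel) = (\<integral>z. F (t - z) * G (z - w) \<partial>lborel) * H w"
      by (simp add: \<Phi>_def mult.assoc[symmetric])
    also have "(\<integral>z. F (t - z) * G (z - w) \<partial>lborel) = conv F G (t - w)"
      using lborel_integral_real_affine[of 1 "\<lambda>z. F (t - z) * G (z - w)" w]
      by (simp add: conv_def algebra_simps)
    finally show "(\<integral>z. \<Phi> (z, w) \<partial>lborel) = conv F G (t - w) * H w" .
  qed simp
  finally show ?thesis by (simp add: conv_def)
qed

section \<open>Truncated kernels and the link between the two notions of integral\<close>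

lemma powr_times_continuous_integrable:
  fixes v :: "real \<Rightarrow> real"
  assumes "p > -1" "0 \<le> c" "continuous_on {0..c} v"
  shows "(\<lambda>x. x powr p * v x) absolutely_integrable_on {0..c}"
proof -
  have "(\<lambda>x. v x * x powr p) absolutely_integrable_on {0..c}"
  proof (rule absolutely_integrable_bounded_measurable_product_real)
    show "v \<in> borel_measurable (lebesgue_on {0..c})"
      using assms by (intro continuous_imp_measurable_on_sets_lebesgue) auto
    show "bounded (v ` {0..c})"
      using assms by (intro compact_imp_bounded compact_continuous_image) auto
    show "(\<lambda>x. x powr p) absolutely_integrable_on {0..c}"
      using integrable_on_powr_from_0[OF assms(1,2)] by (intro nonnegative_absolutely_integrable_1) auto
  qed auto
  then show ?thesis by (simp add: mult.commute)
qed

text \<open>Kernels are constrained on (0, T] only. Setting them to 0 elsewhere makes them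
  integrable over the line and keeps the one-sided convolutions up to time \<open>T\<close>.\<close>

definition trunc :: "real \<Rightarrow> (real \<Rightarrow> real) \<Rightarrow> real \<Rightarrow> real" where
  "trunc T F x = (if 0 < x \<and> x \<le> T then F x else 0)"

lemma trunc_conv_space:
  assumes "continuous_on {0<..T} F" "F absolutely_integrable_on {0..T}"
  shows "trunc T F \<in> conv_space T"
proof (rule conv_spaceI)
  have eq: "trunc T F = (\<lambda>x. indicator {0<..T} x *\<^sub>R F x)"
    by (auto simp: trunc_def fun_eq_iff)
  \<comment> \<open>Absolute integrability refers to the completed measure; Borel measurability,
    from continuity on (0, T], brings it down to \<open>lborel\<close>.\<close>
  have m: "trunc T F \<in> borel_measurable borel"
    unfolding eq using assms(1) by (intro borel_measurable_continuous_on_indicator) auto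
  have "F absolutely_integrable_on {0<..T}"
    by (rule set_integrable_subset[OF assms(2)]) auto
  then have "integrable lebesgue (trunc T F)"
    unfolding set_integrable_def eq .
  then show "integrable lborel (trunc T F)"
    using m integrable_completion[of "trunc T F" lborel] by simp
  show "continuous_on {0<..T} (trunc T F)"
    by (rule continuous_on_eq[OF assms(1)]) (auto simp: trunc_def)
qed (auto simp: trunc_def)

lemma C_minus1_trunc_conv_space:
  assumes "F \<in> C_minus1 T" "0 \<le> T"
  shows "trunc T F \<in> conv_space T"
proof -
  obtain p G where p: "p > -1" and G: "continuous_on {0..T} G"
    and eq: "\<And>x. x \<in> {0<..T} \<Longrightarrow> F x = x powr p * G x"
    using assms unfolding C_minus1_def by blast
  show ?thesis
  proof (rule trunc_conv_space)
    show "continuous_on {0<..T} F"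
    proof (rule continuous_on_eq)
      show "continuous_on {0<..T} (\<lambda>x. x powr p * G x)"
        by (intro continuous_intros continuous_on_subset[OF G]) auto
    qed (simp add: eq)
    show "F absolutely_integrable_on {0..T}"
      by (rule absolutely_integrable_spike[OF powr_times_continuous_integrable[OF p assms(2) G], of "{0}"])
        (auto simp: eq)
  qed
qed

text \<open>Links the gauge integral over [0, t] in the operators to \<open>conv\<close>. The primed
  functions stand for the original ones, which need to agree with members of
  \<open>conv_space\<close> only inside (0, t); the end points form a null set.\<close>

lemma conv_eq_integral:
  assumes F: "F \<in> conv_space T" and G: "G \<in> conv_space T" and t: "t \<le> T"
    and F': "\<And>x. 0 < x \<Longrightarrow> x < t \<Longrightarrow> F' x = F x" and G': "\<And>x. 0 < x \<Longrightarrow> x < t \<Longrightarrow> G' x = G x"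
  shows "(\<lambda>z. F' (t - z) * G' z) absolutely_integrable_on {0..t}"
    and "integral {0..t} (\<lambda>z. F' (t - z) * G' z) = conv F G t"
proof -
  let ?f = "\<lambda>z. F (t - z) * G z"
  note i = conv_integrable[OF F G t]
  have m: "?f \<in> borel_measurable lborel" using i by (rule borel_measurable_integrable)
  have "integrable lebesgue ?f" using i m by (simp add: integrable_completion)
  then have "?f absolutely_integrable_on UNIV"
    by (simp add: set_integrable_def)
  then have a: "?f absolutely_integrable_on {0..t}"
    by (rule set_integrable_subset) auto
  then show "(\<lambda>z. F' (t - z) * G' z) absolutely_integrable_on {0..t}"
    by (rule absolutely_integrable_spike[where S = "{0, t}"]) (auto simp: F' G')
  have z: "?f z = 0" if "z \<notin> {0..t}" for z
    using that conv_spaceD(3)[OF F, of "t - z"] conv_spaceD(3)[OF G, of z]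
    by (cases "z \<le> 0") auto
  have "integral {0..t} (\<lambda>z. F' (t - z) * G' z) = integral {0..t} ?f"
    by (rule integral_spike[where S = "{0, t}"]) (auto simp: F' G')
  also have "\<dots> = integral UNIV (\<lambda>z. if z \<in> {0..t} then ?f z else 0)"
    by (rule integral_restrict_UNIV[symmetric])
  also have "\<dots> = integral UNIV ?f"
    by (rule integral_cong) (use z in auto)
  also have "\<dots> = conv F G t"
    unfolding conv_def by (rule integral_lborel[OF i])
  finally show "integral {0..t} (\<lambda>z. F' (t - z) * G' z) = conv F G t" .
qed

section \<open>Antiderivatives as convolutions and inversion under the Sonin condition\<close>

lemma trunc_one_conv_space: "trunc T (\<lambda>_. 1) \<in> conv_space T"
  by (intro trunc_conv_space continuous_intros absolutely_integrable_on_const) auto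

text \<open>Brings antiderivatives into the convolution algebra, so that they can be moved past a
  kernel by commutativity and associativity.\<close>

lemma conv_space_integral_eq_conv_one:
  assumes "F \<in> conv_space T" "t \<le> T"
  shows "integral {0..t} F = conv (trunc T (\<lambda>_. 1)) F t"
  using conv_eq_integral(2)[OF trunc_one_conv_space assms, of "\<lambda>_. 1" F] assms(2)
  by (auto simp: trunc_def)

lemma conv_one_has_derivative:
  assumes F: "F \<in> conv_space T" and t: "0 < t" "t \<le> T"
  shows "(conv (trunc T (\<lambda>_. 1)) F has_real_derivative F t) (at t within {0..T})"
proof -
  have i: "F integrable_on {0..T}"
    using conv_eq_integral(1)[OF trunc_one_conv_space F, of T "\<lambda>_. 1" F]
    by (auto simp: trunc_def dest: set_lebesgue_integral_eq_integral(1))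
  \<comment> \<open>\<open>F\<close> may be discontinuous at 0, so the fundamental theorem is
    applied with 0 removed; at t > 0 this does not change the filter.\<close>
  have eq: "at t within {0..T} - {0} = at t within {0..T}" 
    using t by (intro at_within_nhd[of _ "{0<..}"]) auto
  have "{0<..T} = {0..T} - {0}" by auto
  then have "continuous (at t within ({0..T} - {0})) F"
    using conv_spaceD(2)[OF F] t by (simp add: continuous_on_eq_continuous_within)
  then have "((\<lambda>u. integral {0..u} F) has_vector_derivative F t) (at t within ({0..T} - {0}))"
    using t by (intro integral_has_vector_derivative_continuous_at[OF i]) auto
  then have "((\<lambda>u. integral {0..u} F) has_real_derivative F t) (at t within {0..T})"
    by (simp only: eq has_real_derivative_iff_has_vector_derivative)
  then show ?thesis
    by (rule has_field_derivative_transform_within[OF _ zero_less_one])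
      (use t conv_space_integral_eq_conv_one[OF F] in auto)
qed

lemma conv_linear_right:
  assumes "F \<in> conv_space T" "G \<in> conv_space T" "H \<in> conv_space T" "t \<le> T"
  shows "conv F (\<lambda>x. c * G x + H x) t = c * conv F G t + conv F H t"
  using conv_integrable[OF assms(1,2,4)] conv_integrable[OF assms(1,3,4)]
  by (simp add: conv_def distrib_left mult.left_commute[of _ c])

text \<open>Values of \<open>F\<close> from t on meet \<open>G\<close> at nonpositive arguments,
  where it vanishes. This lets the Sonin condition, available only up to \<open>T\<close>, be used
  inside a convolution.\<close>

lemma conv_cong_left:
  assumes "G \<in> conv_space T" "t \<le> T" "\<And>x. x < t \<Longrightarrow> F x = F' x"
  shows "conv F G t = conv F' G t"
  unfolding conv_def
proof (rule Bochner_Integration.integral_cong)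
  show "F (t - z) * G z = F' (t - z) * G z" for z
    using assms(3)[of "t - z"] conv_spaceD(3)[OF assms(1), of z] by (cases "z \<le> 0") auto
qed simp

text \<open>\<open>H\<close> stands for f in the new variable, with derivative \<open>h\<close> and
  limit \<open>c\<close> at 0, and \<open>E\<close> for its fractional derivative. Both terms of
  \<open>H\<close> contain the factor \<open>one\<close>; moving it past \<open>K\<close> shows that
  \<open>conv K H\<close> is an antiderivative of \<open>E\<close>.\<close>

lemma sonin_inverse:
  fixes c T :: real
  assumes M: "M \<in> conv_space T" and K: "K \<in> conv_space T" and h: "h \<in> conv_space T"
    and sonin: "\<forall>t\<in>{0<..T}. conv M K t = 1"
  defines "one \<equiv> trunc T (\<lambda>_. 1)"
  defines "H \<equiv> \<lambda>t. c * one t + conv one h t" and "E \<equiv> \<lambda>t. c * K t + conv K h t"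
  shows "E \<in> conv_space T" "H \<in> conv_space T"
    and "0 < t \<Longrightarrow> t \<le> T \<Longrightarrow> (conv K H has_real_derivative E t) (at t within {0..T})"
    and "0 < t \<Longrightarrow> t \<le> T \<Longrightarrow> conv M E t = H t"
proof -
  have one: "one \<in> conv_space T" unfolding one_def by (rule trunc_one_conv_space)
  note cs = conv_in_conv_space conv_space_add conv_space_cmult M K h one
  show E: "E \<in> conv_space T" and H: "H \<in> conv_space T"
    unfolding E_def H_def by (intro cs)+
  have "conv K H s = conv one E s" if s: "s \<le> T" for s
  proof -
    have "conv K H s = c * conv K one s + conv K (conv one h) s"
      unfolding H_def by (intro conv_linear_right[where T = T] cs s)
    also have "conv K (conv one h) s = conv (conv K one) h s"
      by (intro conv_assoc[where T = T] cs s)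
    also have "conv K one = conv one K" by (rule ext) (rule conv_commute)
    also have "conv (conv one K) h s = conv one (conv K h) s"
      by (intro conv_assoc[where T = T, symmetric] cs s)
    also have "c * conv one K s + conv one (conv K h) s = conv one E s"
      unfolding E_def by (intro conv_linear_right[where T = T, symmetric] cs s)
    finally show ?thesis .
  qed
  moreover assume t: "0 < t" "t \<le> T"
  ultimately show "(conv K H has_real_derivative E t) (at t within {0..T})"
    using has_field_derivative_transform_within[OF conv_one_has_derivative[OF E t] zero_less_one,
        of "conv K H"] t unfolding one_def by auto
  have "conv M E t = c * conv M K t + conv M (conv K h) t"
    unfolding E_def by (intro conv_linear_right[where T = T] cs t)
  also have "conv M (conv K h) t = conv (conv M K) h t"
    by (intro conv_assoc[where T = T] cs t)
  also have "\<dots> = conv one h t"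
  proof (rule conv_cong_left[OF h t(2)])
    fix x assume "x < t"
    then show "conv M K x = one x"
      using sonin conv_eq_0(2)[OF M K, of x] t by (auto simp: one_def trunc_def)
  qed
  finally show "conv M E t = H t"
    using sonin t by (simp add: H_def one_def trunc_def)
qed

subsection \<open>Substitution by an increasing function\<close>

lemma deriv_on_eqI:
  assumes "a < b" "x \<in> {a..b}" "(F has_real_derivative d) (at x within {a..b})"
  shows "deriv_on a b F x = d"
  unfolding deriv_on_def using assms
  by (intro vector_derivative_within_closed_interval) (auto simp: has_real_derivative_iff_has_vector_derivative)

lemma deriv_on_works:
  assumes "F differentiable_on {a..b}" "x \<in> {a..b}"
  shows "(F has_real_derivative deriv_on a b F x) (at x within {a..b})"
  using assms unfolding deriv_on_def differentiable_on_def
  by (simp add: has_real_derivative_iff_has_vector_derivative flip: vector_derivative_works)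

locale increasing_substitution =
  fixes a b :: real and g g1 :: "real \<Rightarrow> real"
  assumes less: "a < b"
    and deriv: "\<And>x. x \<in> {a..b} \<Longrightarrow> (g has_real_derivative g1 x) (at x within {a..b})"
    and deriv_pos: "\<And>x. x \<in> {a..b} \<Longrightarrow> 0 < g1 x"
begin

definition g0 :: "real \<Rightarrow> real" where "g0 x = g x - g a"

definition ginv :: "real \<Rightarrow> real" where "ginv = the_inv_into {a..b} g0"

lemma g0_deriv: "x \<in> {a..b} \<Longrightarrow> (g0 has_real_derivative g1 x) (at x within {a..b})"
  unfolding g0_def[abs_def] by (auto intro!: derivative_eq_intros deriv)

lemma g0_continuous: "continuous_on {a..b} g0"
  by (rule DERIV_continuous_on) (rule g0_deriv)

lemma g0_strict_mono:
  assumes "x \<in> {a..b}" "y \<in> {a..b}" "x < y"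
  shows "g0 x < g0 y"
proof (rule DERIV_pos_imp_increasing_open[OF \<open>x < y\<close>])
  fix z assume z: "x < z" "z < y"
  then have "at z within {a..b} = at z"
    using assms by (intro at_within_interior) auto
  then show "\<exists>d. (g0 has_real_derivative d) (at z) \<and> 0 < d"
    using g0_deriv[of z] deriv_pos[of z] z assms by auto
qed (use assms in \<open>auto intro: continuous_on_subset[OF g0_continuous]\<close>)

lemma g0_at_a: "g0 a = 0" by (simp add: g0_def)

lemma g0_pos: "a < x \<Longrightarrow> x \<le> b \<Longrightarrow> 0 < g0 x"
  using g0_strict_mono[of a x] less by (simp add: g0_at_a)

lemma g0_mono: "a \<le> x \<Longrightarrow> x \<le> y \<Longrightarrow> y \<le> b \<Longrightarrow> g0 x \<le> g0 y"
  using g0_strict_mono[of x y] by (cases "x = y") auto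

lemma g0_inj: "inj_on g0 {a..b}"
  by (rule linorder_inj_onI) (use g0_strict_mono in \<open>auto simp: less_imp_neq\<close>)

lemma g0_image:
  assumes "x \<in> {a..b}"
  shows "g0 ` {a..x} = {0..g0 x}"
proof
  show "g0 ` {a..x} \<subseteq> {0..g0 x}"
    using assms g0_mono[of a] by (auto simp: g0_at_a intro!: g0_mono)
  show "{0..g0 x} \<subseteq> g0 ` {a..x}"
  proof
    fix t assume "t \<in> {0..g0 x}"
    then have "\<exists>u\<ge>a. u \<le> x \<and> g0 u = t"
      using assms by (intro IVT' continuous_on_subset[OF g0_continuous]) (auto simp: g0_at_a)
    then show "t \<in> g0 ` {a..x}" by auto
  qed
qed

lemma ginv_g0 [simp]: "x \<in> {a..b} \<Longrightarrow> ginv (g0 x) = x"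
  unfolding ginv_def using g0_inj by (rule the_inv_into_f_f)

lemma ginv_continuous: "continuous_on {0..g0 b} ginv"
  using continuous_on_inv_into[OF g0_continuous compact_Icc g0_inj] g0_image[of b] less
  by (simp add: ginv_def)

lemma ginv_range:
  assumes "0 < t" "t \<le> g0 b"
  shows "a < ginv t" "ginv t \<le> b" "g0 (ginv t) = t"
proof -
  have "t \<in> g0 ` {a..b}" using assms g0_image[of b] less by auto
  then obtain x where x: "x \<in> {a..b}" "t = g0 x" by auto
  with assms have "x \<noteq> a" by (auto simp: g0_at_a)
  with x show "a < ginv t" "ginv t \<le> b" "g0 (ginv t) = t" by auto
qed

text \<open>The Jacobian \<open>\<bar>g1 u\<bar>\<close> loses its absolute value by positivity.
  Both directions of the equivalence serve: integrability of the transformed derivative of f is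
  obtained from left to right, the values of the operators from right to left.\<close>

lemma change_of_variables:
  assumes "x \<in> {a..b}"
  shows "(\<lambda>u. \<phi> (g0 u) * g1 u) absolutely_integrable_on {a..x} \<and> integral {a..x} (\<lambda>u. \<phi> (g0 u) * g1 u) = I
    \<longleftrightarrow> \<phi> absolutely_integrable_on {0..g0 x} \<and> integral {0..g0 x} \<phi> = I"
proof -
  have eq: "\<bar>g1 u\<bar> * \<phi> (g0 u) = \<phi> (g0 u) * g1 u" if "u \<in> {a..x}" for u
    using deriv_pos[of u] that assms by auto
  have "((\<lambda>u. \<bar>g1 u\<bar> * \<phi> (g0 u)) absolutely_integrable_on {a..x} \<and>
      integral {a..x} (\<lambda>u. \<bar>g1 u\<bar> * \<phi> (g0 u)) = I)
    \<longleftrightarrow> \<phi> absolutely_integrable_on g0 ` {a..x} \<and> integral (g0 ` {a..x}) \<phi> = I"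
    by (rule has_absolute_integral_change_of_variables_1')
      (use assms in \<open>auto intro: DERIV_subset[OF g0_deriv] inj_on_subset[OF g0_inj]\<close>)
  moreover have "(\<lambda>u. \<bar>g1 u\<bar> * \<phi> (g0 u)) absolutely_integrable_on {a..x}
      \<longleftrightarrow> (\<lambda>u. \<phi> (g0 u) * g1 u) absolutely_integrable_on {a..x}"
    by (intro set_integrable_cong refl eq)
  moreover have "integral {a..x} (\<lambda>u. \<bar>g1 u\<bar> * \<phi> (g0 u)) = integral {a..x} (\<lambda>u. \<phi> (g0 u) * g1 u)"
    by (intro Henstock_Kurzweil_Integration.integral_cong eq)
  ultimately show ?thesis using g0_image[OF assms] by simp
qed

text \<open>Since \<open>g'\<close> need not be continuous at \<open>a\<close>, \<open>g x - g a\<close> is compared with \<open>x - a\<close> through the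
  difference quotient, which is continuous and positive up to \<open>a\<close>.\<close>

lemma powr_g0_integrable:
  assumes p: "p > -1" and v: "continuous_on {a..b} v"
  shows "(\<lambda>x. g0 x powr p * v x) absolutely_integrable_on {a..b}"
proof -
  define r where "r x = (if x = a then g1 a else g0 x / (x - a))" for x
  have r_pos: "0 < r x" if "x \<in> {a..b}" for x
    using that g0_pos[of x] deriv_pos[of a] less by (auto simp: r_def)
  have r_cont: "continuous_on {a..b} r"
    unfolding continuous_on_eq_continuous_within
  proof
    fix x assume x: "x \<in> {a..b}"
    show "continuous (at x within {a..b}) r"
    proof (cases "x = a")
      case True
      have "((\<lambda>y. (g0 y - g0 a) / (y - a)) \<longlongrightarrow> g1 a) (at a within {a..b})"
        using g0_deriv[of a] less by (simp add: has_field_derivative_iff)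
      then have "(r \<longlongrightarrow> g1 a) (at a within {a..b})"
        by (rule Lim_transform_eventually) (auto simp: eventually_at_filter r_def g0_at_a)
      then show ?thesis using True by (simp add: continuous_within r_def)
    next
      case False
      then have ax: "a < x" using x by auto
      have "continuous_on {a<..b} r"
      proof (rule continuous_on_eq)
        show "continuous_on {a<..b} (\<lambda>x. g0 x / (x - a))"
          by (intro continuous_intros continuous_on_subset[OF g0_continuous]) auto
      qed (auto simp: r_def)
      then have "continuous (at x within {a<..b}) r"
        using ax x by (auto simp: continuous_on_eq_continuous_within)
      moreover have "at x within {a<..b} = at x within {a..b}"
        by (rule at_within_nhd[of _ "{a<..}"]) (use ax in auto)
      ultimately show ?thesis by simp
    qed
  qed
  \<comment> \<open>Since g0 (a + s) = s * r (a + s), the weight splits into powers of s and of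
    \<open>r\<close>; positivity of \<open>r\<close> keeps the latter continuous even for negative
    \<open>p\<close>.\<close>
  have "(\<lambda>s. s powr p * (r (a + s) powr p * v (a + s))) absolutely_integrable_on {0..b - a}"
  proof (rule powr_times_continuous_integrable[OF p])
    have "continuous_on {a..b} (\<lambda>x. r x powr p * v x)"
      by (intro continuous_intros r_cont v) (use r_pos in \<open>auto simp: less_imp_neq[THEN not_sym]\<close>)
    then show "continuous_on {0..b - a} (\<lambda>s. r (a + s) powr p * v (a + s))"
      by (rule continuous_on_compose2[where f = "\<lambda>s. a + s"]) (auto intro!: continuous_intros)
  qed (use less in auto)
  then have "(\<lambda>s. g0 (a + s) powr p * v (a + s)) absolutely_integrable_on {0..b - a}"
  proof (rule absolutely_integrable_spike[where S = "{0}"])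
    fix s assume s: "s \<in> {0..b - a} - {0}"
    then have "g0 (a + s) = s * r (a + s)" by (simp add: r_def)
    then show "g0 (a + s) powr p * v (a + s) = s powr p * (r (a + s) powr p * v (a + s))"
      using s r_pos[of "a + s"] by (simp add: powr_mult)
  qed auto
  moreover have "(\<lambda>x. x - a) ` {a..b} = {0..b - a}"
    by (simp add: image_diff_atLeastAtMost)
  moreover have "((\<lambda>x. x - a) has_real_derivative 1) (at x within {a..b})" for x
    by (auto intro!: derivative_eq_intros)
  ultimately show ?thesis
    using has_absolute_integral_change_of_variables_1'[of "{a..b}" "\<lambda>x. x - a" "\<lambda>_. 1"
        "\<lambda>s. g0 (a + s) powr p * v (a + s)"
        "integral {0..b - a} (\<lambda>s. g0 (a + s) powr p * v (a + s))"]
    by (simp add: inj_on_def)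
qed

section \<open>The left-sided operators as convolutions\<close>

text \<open>Differentiability of the inner integral \<open>J\<close> is a conclusion of its own
  because \<open>deriv_on\<close> is total: the reflection to the right-sided case requires that the
  derivative exist.\<close>

lemma I_left_D_left:
  assumes g1: "continuous_on {a<..b} g1" and luchko: "(M, K) \<in> luchko_set (g b - g a)"
    and f: "f \<in> C1_left g a b" and x: "x \<in> {a<..b}"
  defines "J \<equiv> \<lambda>y. integral {a..y} (\<lambda>u. K (g y - g u) * f u * deriv_on a b g u)"
  shows "(J has_real_derivative deriv_on a b J x) (at x within {a..b})"
    and "I_left M g a b (D_left K g a b f) x = f x"
proof -
  define T where "T = g0 b"
  have T: "0 < T" using g0_pos[of b] less by (simp add: T_def)
  have Teq: "g b - g a = T" by (simp add: T_def g0_def)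
  have g1_eq: "deriv_on a b g u = g1 u" if "u \<in> {a..b}" for u
    using deriv_on_eqI[OF less that deriv[OF that]] .
  define M0 where "M0 = trunc T M"
  define K0 where "K0 = trunc T K"
  have M0: "M0 \<in> conv_space T" and K0: "K0 \<in> conv_space T"
    using luchko T by (auto simp: luchko_set_def Teq M0_def K0_def intro!: C_minus1_trunc_conv_space)
  have sonin: "\<forall>t\<in>{0<..T}. conv M0 K0 t = 1"
  proof
    fix t assume t: "t \<in> {0<..T}"
    have "integral {0..t} (\<lambda>z. M (t - z) * K z) = conv M0 K0 t"
      by (rule conv_eq_integral(2)[OF M0 K0]) (use t in \<open>auto simp: M0_def K0_def trunc_def\<close>)
    then show "conv M0 K0 t = 1" using luchko t by (auto simp: luchko_set_def Teq)
  qed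
  obtain p v where p: "p > -1" and v: "continuous_on {a..b} v"
    and f1: "\<And>x. x \<in> {a<..b} \<Longrightarrow> (f has_real_derivative (g x - g a) powr p * v x) (at x within {a..b})"
    using f unfolding C1_left_def by auto
  define f1 where "f1 x = g0 x powr p * v x" for x
  have f_deriv: "(f has_real_derivative f1 x) (at x within {a..b})" if "x \<in> {a<..b}" for x
    using f1[OF that] by (simp add: f1_def g0_def)
  have f1_int: "f1 absolutely_integrable_on {a..b}"
    unfolding f1_def[abs_def] by (rule powr_g0_integrable[OF p v])
  have f1_cont: "continuous_on {a<..b} f1"
    unfolding f1_def[abs_def]
    by (intro continuous_intros continuous_on_subset[OF g0_continuous] continuous_on_subset[OF v])
      (use g0_pos in \<open>auto simp: less_imp_neq[THEN not_sym]\<close>)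
  \<comment> \<open>The derivative of \<open>f\<close> with respect to t = g0 x, by the chain
    rule.\<close>
  define h where "h s = f1 (ginv s) / g1 (ginv s)" for s
  have h_eq: "h (g0 u) * g1 u = f1 u" if "u \<in> {a..b}" for u
    using that deriv_pos[OF that] by (simp add: h_def)
  have h_sub: "h absolutely_integrable_on {0..g0 y} \<and> integral {0..g0 y} h = integral {a..y} f1"
    if y: "y \<in> {a..b}" for y
  proof -
    have "f1 absolutely_integrable_on {a..y}"
      using y by (intro set_integrable_subset[OF f1_int]) auto
    moreover have "(\<lambda>u. h (g0 u) * g1 u) absolutely_integrable_on {a..y} \<longleftrightarrow> f1 absolutely_integrable_on {a..y}"
      using y by (intro set_integrable_cong refl h_eq) auto
    moreover have "integral {a..y} (\<lambda>u. h (g0 u) * g1 u) = integral {a..y} f1"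
      using y by (intro Henstock_Kurzweil_Integration.integral_cong h_eq) auto
    ultimately show ?thesis
      using change_of_variables[OF y, of h "integral {a..y} f1"] by simp
  qed
  define h0 where "h0 = trunc T h"
  have h0: "h0 \<in> conv_space T"
    unfolding h0_def
  proof (rule trunc_conv_space)
    show "h absolutely_integrable_on {0..T}"
      using h_sub[of b] less by (simp add: T_def)
    have gi: "continuous_on {0<..T} ginv"
      by (rule continuous_on_subset[OF ginv_continuous]) (auto simp: T_def)
    have r: "ginv ` {0<..T} \<subseteq> {a<..b}"
      using ginv_range by (auto simp: T_def)
    show "continuous_on {0<..T} h"
      unfolding h_def[abs_def]
      using deriv_pos r
      by (intro continuous_intros continuous_on_compose2[OF f1_cont gi] continuous_on_compose2[OF g1 gi])
        (fastforce simp: less_imp_neq[THEN not_sym])+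
  qed
  \<comment> \<open>This is the limit of \<open>f\<close> at \<open>a\<close>, since f y = c +
    integral {a..y} f1 as shown below. It is computed from \<open>b\<close> because the value
    \<open>f a\<close> is unconstrained.\<close>
  define c where "c = f b - integral {a..b} f1"
  define H where "H = (\<lambda>t. c * trunc T (\<lambda>_. 1) t + conv (trunc T (\<lambda>_. 1)) h0 t)"
  define E where "E = (\<lambda>t. c * K0 t + conv K0 h0 t)"
  note S = sonin_inverse[OF M0 K0 h0 sonin, where c = c, folded E_def H_def]
  have g0_range: "0 < g0 y" "g0 y \<le> T" if "y \<in> {a<..b}" for y
    using that g0_pos[of y] g0_mono[of y b] by (auto simp: T_def)
  have f_H: "f y = H (g0 y)" if y: "y \<in> {a<..b}" for y
  proof -
    \<comment> \<open>The interval [y, b] stays away from \<open>a\<close>, so \<open>f\<close> is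
      differentiable throughout.\<close>
    have "(f1 has_integral (f b - f y)) {y..b}"
    proof (rule fundamental_theorem_of_calculus)
      fix z assume "z \<in> {y..b}"
      then show "(f has_vector_derivative f1 z) (at z within {y..b})"
        using f_deriv[of z] y DERIV_subset[of f "f1 z" z "{a..b}" "{y..b}"]
        by (auto simp: has_real_derivative_iff_has_vector_derivative)
    qed (use y in auto)
    then have "integral {y..b} f1 = f b - f y" by (rule integral_unique)
    moreover have "integral {a..y} f1 + integral {y..b} f1 = integral {a..b} f1"
      using y set_lebesgue_integral_eq_integral(1)[OF f1_int]
      by (intro Henstock_Kurzweil_Integration.integral_combine) auto
    ultimately have "f y = c + integral {a..y} f1" by (simp add: c_def)
    also have "integral {a..y} f1 = integral {0..g0 y} h" using h_sub[of y] y by simp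
    also have "\<dots> = integral {0..g0 y} h0"
      by (rule integral_spike[where S = "{0}"]) (use g0_range[OF y] in \<open>auto simp: h0_def trunc_def\<close>)
    also have "\<dots> = conv (trunc T (\<lambda>_. 1)) h0 (g0 y)"
      by (rule conv_space_integral_eq_conv_one[OF h0]) (use g0_range[OF y] in auto)
    finally show ?thesis using g0_range[OF y] by (simp add: H_def trunc_def)
  qed
  have J_eq: "J y = conv K0 H (g0 y)" if y: "y \<in> {a<..b}" for y
  proof -
    let ?\<phi> = "\<lambda>s. K (g0 y - s) * f (ginv s)"
    have H_eq: "f (ginv s) = H s" if "0 < s" "s < g0 y" for s
      using f_H[of "ginv s"] ginv_range[of s] that g0_range[OF y] by (auto simp: T_def)
    have "?\<phi> absolutely_integrable_on {0..g0 y}" "integral {0..g0 y} ?\<phi> = conv K0 H (g0 y)"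
      by (rule conv_eq_integral[OF K0 S(2)]; use g0_range[OF y] H_eq in \<open>auto simp: K0_def trunc_def\<close>)+
    then have "integral {a..y} (\<lambda>u. ?\<phi> (g0 u) * g1 u) = conv K0 H (g0 y)"
      using change_of_variables[of y ?\<phi>] y by auto
    also have "integral {a..y} (\<lambda>u. ?\<phi> (g0 u) * g1 u) = J y"
      unfolding J_def
      by (rule Henstock_Kurzweil_Integration.integral_cong)
        (use y in \<open>auto simp: g1_eq g0_def[symmetric]\<close>, auto simp: g0_def)
    finally show ?thesis by simp
  qed
  have J_deriv: "(J has_real_derivative E (g0 y) * g1 y) (at y within {a..b})" if y: "y \<in> {a<..b}" for y
  proof -
    have "(conv K0 H \<circ> g0 has_real_derivative E (g0 y) * g1 y) (at y within {a..b})"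
    proof (rule DERIV_image_chain)
      show "(conv K0 H has_real_derivative E (g0 y)) (at (g0 y) within g0 ` {a..b})"
        using S(3)[OF g0_range[OF y]] g0_image[of b] less by (simp add: T_def E_def)
    qed (use y g0_deriv in auto)
    then show ?thesis
      by (rule has_field_derivative_transform_within[where d = "y - a"])
        (use y J_eq in \<open>auto simp: dist_real_def\<close>)
  qed
  have J_deriv_on: "deriv_on a b J y = E (g0 y) * g1 y" if "y \<in> {a<..b}" for y
    using deriv_on_eqI[OF less _ J_deriv[OF that]] that by simp
  then show "(J has_real_derivative deriv_on a b J x) (at x within {a..b})"
    using J_deriv x by simp
  \<comment> \<open>The chain-rule factor \<open>g1\<close> cancels against the reciprocal
    derivative in the operator.\<close>
  have D_eq: "D_left K g a b f y = E (g0 y)" if "y \<in> {a<..b}" for y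
    unfolding D_left_def J_def[symmetric] J_deriv_on[OF that]
    using that deriv_pos[of y] by (auto simp: g1_eq)
  let ?\<psi> = "\<lambda>s. M (g0 x - s) * E s"
  have "?\<psi> absolutely_integrable_on {0..g0 x}" "integral {0..g0 x} ?\<psi> = conv M0 E (g0 x)"
    by (rule conv_eq_integral[OF M0 S(1)]; use g0_range[OF x] in \<open>auto simp: M0_def trunc_def\<close>)+
  then have "integral {a..x} (\<lambda>u. ?\<psi> (g0 u) * g1 u) = conv M0 E (g0 x)"
    using change_of_variables[of x ?\<psi>] x by auto
  also have "integral {a..x} (\<lambda>u. ?\<psi> (g0 u) * g1 u) = I_left M g a b (D_left K g a b f) x"
    unfolding I_left_def
  \<comment> \<open>\<open>D_eq\<close> says nothing at \<open>a\<close>, which is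
    negligible.\<close>
  proof (rule integral_spike[where S = "{a}"])
    fix u assume "u \<in> {a..x} - {a}"
    then have u: "u \<in> {a<..b}" using x by auto
    then show "M (g x - g u) * D_left K g a b f u * deriv_on a b g u = ?\<psi> (g0 u) * g1 u"
      by (simp add: D_eq[OF u] g1_eq) (simp add: g0_def)
  qed auto
  also have "conv M0 E (g0 x) = f x"
    using S(4)[OF g0_range[OF x]] f_H[OF x] by (simp add: H_def)
  finally show "I_left M g a b (D_left K g a b f) x = f x" by simp
qed

end

section \<open>Positivity of the derivative of a monotone substitution\<close>

text \<open>Inside, monotonicity makes the derivative nonnegative, hence positive as it is nonzero.
  Continuity then extends strict increase to [a, b], so the difference quotients at the end points
  are nonnegative too, and so is their limit.\<close>

lemma increasing_substitution_deriv_on: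
  assumes less: "a < b" and mono: "mono_on {a<..<b} g" and diff: "g differentiable_on {a..b}"
    and nz: "\<And>x. x \<in> {a..b} \<Longrightarrow> deriv_on a b g x \<noteq> 0"
  shows "increasing_substitution a b g (deriv_on a b g)"
proof
  show "a < b" by fact
  show d: "(g has_real_derivative deriv_on a b g x) (at x within {a..b})" if "x \<in> {a..b}" for x
    using deriv_on_works[OF diff that] .
  have d_open: "DERIV g x :> deriv_on a b g x" if "x \<in> {a<..<b}" for x
    using d[of x] that at_within_interior[of x "{a..b}"] by auto
  have pos_open: "0 < deriv_on a b g x" if "x \<in> {a<..<b}" for x
  proof -
    have "0 \<le> deriv_on a b g x"
      by (rule mono_on_imp_deriv_nonneg[OF mono d_open]) (use that in auto)
    with nz[of x] that show ?thesis by auto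
  qed
  have strict: "g x < g y" if "a \<le> x" "x < y" "y \<le> b" for x y
  proof (rule DERIV_pos_imp_increasing_open[OF that(2)])
    show "continuous_on {x..y} g"
      by (rule continuous_on_subset[OF differentiable_imp_continuous_on[OF diff]]) (use that in auto)
    show "\<exists>d. (g has_real_derivative d) (at z) \<and> 0 < d" if "x < z" "z < y" for z
      using d_open[of z] pos_open[of z] that \<open>a \<le> x\<close> \<open>y \<le> b\<close> by auto
  qed
  show "0 < deriv_on a b g x" if x: "x \<in> {a..b}" for x
  proof -
    have "0 \<le> deriv_on a b g x"
    proof (rule tendsto_lowerbound)
      show "((\<lambda>y. (g y - g x) / (y - x)) \<longlongrightarrow> deriv_on a b g x) (at x within {a..b})"
        using d[OF x] by (simp add: has_field_derivative_iff)
      have "0 \<le> (g y - g x) / (y - x)" if "y \<in> {a..b}" "y \<noteq> x" for y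
        using strict[of x y] strict[of y x] that x by
          (cases y x rule: linorder_cases) (auto simp: divide_nonpos_nonpos)
      then show "\<forall>\<^sub>F y in at x within {a..b}. 0 \<le> (g y - g x) / (y - x)"
        by (simp add: eventually_at_filter)
      have "x islimpt {a..b}"
        using less x by (intro connected_imp_perfect) auto
      then show "at x within {a..b} \<noteq> bot"
        by (simp add: trivial_limit_within)
    qed
    with nz[OF x] show ?thesis by linarith
  qed
qed

text \<open>The conditions on \<open>g\<close> are listed one by one so that the reflected function
  y \<mapsto> - g (- y), which takes negative values, can be supplied as well.\<close>

lemma I_left_D_left_mono:
  fixes a b :: real
  assumes less: "a < b" and mono: "mono_on {a<..<b} g" and diff: "g differentiable_on {a..b}"
    and cont: "continuous_on {a<..b} (deriv_on a b g)"
    and nz: "\<And>x. x \<in> {a..b} \<Longrightarrow> deriv_on a b g x \<noteq> 0"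
    and MK: "(M, K) \<in> luchko_set (g b - g a)" and f: "f \<in> C1_left g a b" and x: "x \<in> {a<..b}"
  defines "J \<equiv> \<lambda>y. integral {a..y} (\<lambda>u. K (g y - g u) * f u * deriv_on a b g u)"
  shows "(J has_real_derivative deriv_on a b J x) (at x within {a..b})"
    and "I_left M g a b (D_left K g a b f) x = f x"
proof -
  interpret increasing_substitution a b g "deriv_on a b g"
    using less mono diff nz by (rule increasing_substitution_deriv_on)
  show "(J has_real_derivative deriv_on a b J x) (at x within {a..b})"
    unfolding J_def by (rule I_left_D_left(1)[OF cont MK f x])
  show "I_left M g a b (D_left K g a b f) x = f x"
    by (rule I_left_D_left(2)[OF cont MK f x])
qed

section \<open>Reflection and the right-sided operators\<close>

lemma has_derivative_reflect:
  fixes F :: "real \<Rightarrow> real"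
  assumes "(F has_real_derivative d) (at x within {a..b})"
  shows "((\<lambda>y. F (- y)) has_real_derivative - d) (at (- x) within {-b..-a})"
proof -
  have "(F \<circ> uminus has_real_derivative d * - 1) (at (- x) within {-b..-a})"
  proof (rule DERIV_image_chain)
    show "(F has_real_derivative d) (at (- (- x)) within uminus ` {-b..-a})"
      using assms by simp
  qed (auto intro!: derivative_eq_intros)
  then show ?thesis by (simp add: o_def)
qed

lemma deriv_on_reflect:
  assumes "a < b" "x \<in> {a..b}" "(F has_real_derivative d) (at x within {a..b})"
  shows "deriv_on (-b) (-a) (\<lambda>y. F (- y)) (- x) = - deriv_on a b F x"
  using deriv_on_eqI[OF assms] deriv_on_eqI[OF _ _ has_derivative_reflect[OF assms(3)]] assms(1,2)
  by simp

text \<open>The two signs in G y = - g (- y) cancel on differentiation, so \<open>G\<close> is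
  increasing, and G (- a) - G (- b) = g b - g a leaves the kernel condition unchanged. The
  left-sided result on [-b, -a] then applies to f (- y).\<close>

lemma I_right_D_right:
  fixes a b :: real
  assumes less: "a < b" and MK: "(M, K) \<in> luchko_set (g b - g a)"
    and g: "g \<in> G_right a b" and f: "f \<in> C1_right g a b" and x: "x \<in> {a..<b}"
  shows "I_right M g a b (D_right K g a b f) x = f x"
proof -
  define F G where "F y = f (- y)" and "G y = - g (- y)" for y
  have mono: "mono_on {a<..<b} g" and diff: "g differentiable_on {a..b}"
    and cont: "continuous_on {a..<b} (deriv_on a b g)"
    and nz: "\<And>x. x \<in> {a..b} \<Longrightarrow> deriv_on a b g x \<noteq> 0"
    using g by (auto simp: G_right_def)
  have G_deriv: "(G has_real_derivative deriv_on a b g (- y)) (at y within {-b..-a})"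
    if "y \<in> {-b..-a}" for y
    using DERIV_minus[OF has_derivative_reflect[OF deriv_on_works[OF diff, of "- y"]]] that
    by (simp add: G_def[abs_def])
  have less': "- b < - a" using less by simp
  have G_deriv_on: "deriv_on (-b) (-a) G y = deriv_on a b g (- y)" if "y \<in> {-b..-a}" for y
    using deriv_on_eqI[OF less' that G_deriv[OF that]] .
  obtain q v where q: "q > -1" and v: "continuous_on {a..b} v"
    and f': "\<And>x. x \<in> {a..<b} \<Longrightarrow> (f has_real_derivative (g b - g x) powr q * v x) (at x within {a..b})"
    using f unfolding C1_right_def by auto
  have F_C1: "F \<in> C1_left G (-b) (-a)"
    unfolding C1_left_def
  proof (intro CollectI exI conjI ballI)
    \<comment> \<open>The minus sign from the chain rule is absorbed into the continuous
      factor.\<close>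
    show "continuous_on {-b..-a} (\<lambda>y. - v (- y))"
      by (intro continuous_intros continuous_on_compose2[OF v]) auto
    fix y assume "y \<in> {-b<..-a}"
    then show "(F has_real_derivative (G y - G (-b)) powr q * - v (- y)) (at y within {-b..-a})"
      using has_derivative_reflect[OF f'[of "- y"]] by (simp add: F_def[abs_def] G_def)
  qed (rule q)
  have G_mono: "mono_on {-b<..<-a} G"
    using mono by (auto simp: G_def mono_on_def)
  have G_diff: "G differentiable_on {-b..-a}"
    using G_deriv unfolding differentiable_on_def real_differentiable_def by blast
  have G_cont: "continuous_on {-b<..-a} (deriv_on (-b) (-a) G)"
  proof (rule continuous_on_eq)
    show "continuous_on {-b<..-a} (\<lambda>y. deriv_on a b g (- y))"
      by (intro continuous_on_compose2[OF cont] continuous_intros) auto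
  qed (simp add: G_deriv_on)
  have G_nz: "deriv_on (-b) (-a) G y \<noteq> 0" if "y \<in> {-b..-a}" for y
    using nz[of "- y"] that by (simp add: G_deriv_on[OF that])
  have G_MK: "(M, K) \<in> luchko_set (G (-a) - G (-b))"
    using MK by (simp add: G_def)
  note L = I_left_D_left_mono[OF less' G_mono G_diff G_cont G_nz G_MK F_C1]
  define J where "J y = integral {y..b} (\<lambda>u. K (g u - g y) * f u * deriv_on a b g u)" for y
  \<comment> \<open>Kept general in \<open>N\<close> and \<open>\<phi>\<close> for two uses:
    \<open>K\<close> with \<open>f\<close> in the derivative, and \<open>M\<close> with the
    derivative of \<open>f\<close> in the outer integral.\<close>
  have reflect: "integral {-b..-y} (\<lambda>u. N (G (-y) - G u) * \<phi> (-u) * deriv_on (-b) (-a) G u)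
      = integral {y..b} (\<lambda>u. N (g u - g y) * \<phi> u * deriv_on a b g u)"
    if "y \<in> {a..b}" for y and N \<phi> :: "real \<Rightarrow> real"
  proof -
    have "integral {-b..-y} (\<lambda>u. N (G (-y) - G u) * \<phi> (-u) * deriv_on (-b) (-a) G u)
      = integral {-b..-y} (\<lambda>u. N (g (- u) - g y) * \<phi> (- u) * deriv_on a b g (- u))"
      using that by (intro Henstock_Kurzweil_Integration.integral_cong) (auto simp: G_def G_deriv_on)
    also have "\<dots> = integral {y..b} (\<lambda>u. N (g u - g y) * \<phi> u * deriv_on a b g u)"
      by (rule Henstock_Kurzweil_Integration.integral_reflect_real)
    finally show ?thesis .
  qed
  define J' where "J' y = integral {-b..y} (\<lambda>u. K (G y - G u) * F u * deriv_on (-b) (-a) G u)" for y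
  have J_eq: "J' (- y) = J y" if "y \<in> {a..b}" for y
    using reflect[OF that, of K f] by (simp add: J_def J'_def F_def)
  have D_eq: "D_right K g a b f y = D_left K G (-b) (-a) F (- y)" if y: "y \<in> {a..<b}" for y
  proof -
    \<comment> \<open>Existence of this derivative justifies the chain rule for the reflection; the
      sign it produces is offset by the one in \<open>D_right\<close>.\<close>
    have "(J' has_real_derivative deriv_on (-b) (-a) J' (- y)) (at (- y) within {-b..-a})"
      using L(1)[of "- y"] y by (simp add: J'_def[abs_def])
    from has_derivative_reflect[OF this]
    have "((\<lambda>z. J' (- z)) has_real_derivative - deriv_on (-b) (-a) J' (- y)) (at y within {a..b})"
      by simp
    then have "(J has_real_derivative - deriv_on (-b) (-a) J' (- y)) (at y within {a..b})"
      by (rule has_field_derivative_transform_within[OF _ zero_less_one]) (use y J_eq in auto)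
    then have "deriv_on a b J y = - deriv_on (-b) (-a) J' (- y)"
      using deriv_on_eqI[OF less] y by auto
    then show ?thesis
      using y by (simp add: D_right_def D_left_def G_deriv_on J_def[abs_def] J'_def[abs_def])
  qed
  have "I_right M g a b (D_right K g a b f) x
      = integral {-b..-x} (\<lambda>u. M (G (-x) - G u) * D_right K g a b f (-u) * deriv_on (-b) (-a) G u)"
    unfolding I_right_def using x by (intro reflect[symmetric]) auto
  also have "\<dots> = I_left M G (-b) (-a) (D_left K G (-b) (-a) F) (- x)"
    unfolding I_left_def
    \<comment> \<open>The point -b corresponds to \<open>b\<close>, which \<open>D_eq\<close>
      excludes.\<close>
    by (rule integral_spike[where S = "{-b}"]) (use x in \<open>auto simp: D_eq\<close>)
  also have "\<dots> = F (- x)"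
    using L(2)[of "- x"] x by simp
  finally show ?thesis by (simp add: F_def)
qed

theorem theorem3:
  fixes a b :: real and M K f g :: "real \<Rightarrow> real"
  assumes "a < b"
    and "(M, K) \<in> luchko_set (g b - g a)"
  shows "(f \<in> C1_left g a b \<longrightarrow> g \<in> G_left a b \<longrightarrow>
           (\<forall>x\<in>{a<..b}. I_left M g a b (D_left K g a b f) x = f x)) \<and>
         (f \<in> C1_right g a b \<longrightarrow> g \<in> G_right a b \<longrightarrow>
           (\<forall>x\<in>{a..<b}. I_right M g a b (D_right K g a b f) x = f x))"
  using I_left_D_left_mono(2)[OF assms(1) _ _ _ _ assms(2)] I_right_D_right[OF assms]
  unfolding G_left_def by blast

end
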